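(* Let $G$ be a finite simple connected graph of diameter $2$ on $n$ vertices. Then the following are equivalent: (1) $G$ is Bonnet-Myers sharp, i.e. $\inf_{x\sim y}\kappa_{LLY}(x,y)=\frac{2}{\operatorname{diam}(G)}=1$; (2) $G$ can be obtained by deleting a matching (a set of pairwise disjoint edges) from the complete graph $K_n$.
   Context: All graphs are finite, simple, undirected, unweighted and connected; $d(x,y)$ is the combinatorial (shortest path) distance, $d_x$ the degree of $x$, and $x\sim y$ means $x,y$ are adjacent. For $p\in[0,1]$ and a vertex $x$ define the probability measure $\mu_x^p(z)=p$ if $z=x$, $\mu_x^p(z)=\frac{1-p}{d_x}$ if $z\sim x$, and $0$ otherwise. For probability measures $\mu_1,\mu_2$ on $V$, the Wasserstein distance is $W_1(\mu_1,\mu_2)=\inf_\pi\sum_{x,y}d(x,y)\pi(x,y)$, the infimum over all $\pi:V\times V\to[0,1]$ with $\sum_y\pi(x,y)=\mu_1(x)$ and $\sum_x\pi(x,y)=\mu_2(y)$. For an edge $x\sim y$, $\kappa_p(x,y)=1-W_1(\mu_x^p,\mu_y^p)$ and the Lin–Lu–Yau Ollivier-Ricci curvature is $\kappa_{LLY}(x,y)=\lim_{p\to1}\frac{\kappa_p(x,y)}{1-p}$. A graph $G$ is called Bonnet-Myers sharp if $\inf_{x\sim y}\kappa_{LLY}(x,y)=\frac{2}{\operatorname{diam}(G)}$. *)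

theory Defs
  imports "Graph_Theory.Graph_Theory"
begin

text \<open>
  A finite simple undirected graph is a \<^locale>\<open>pair_graph\<close>: an edge joining x and y is represented
  by the two arcs (x, y) and (y, x).  The functions below take real values; they are meant for
  connected graphs, where all distances are finite.
\<close>

definition graph_dist :: "'a pair_pre_digraph \<Rightarrow> 'a \<Rightarrow> 'a \<Rightarrow> real" where
  "graph_dist G x y = real_of_ereal (wf_digraph.\<mu> (with_proj G) (\<lambda>_. 1) x y)"

definition diam :: "'a pair_pre_digraph \<Rightarrow> real" where
  "diam G = (SUP (x, y) \<in> pverts G \<times> pverts G. graph_dist G x y)"

text \<open>
  In a symmetric digraph the out-degree is the degree of the underlying undirected graph.
\<close>

definition lazy_measure :: "'a pair_pre_digraph \<Rightarrow> real \<Rightarrow> 'a \<Rightarrow> 'a \<Rightarrow> real" where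
  "lazy_measure G p x z =
     (if z = x then p
      else if (x, z) \<in> parcs G then (1 - p) / real (out_degree (with_proj G) x)
      else 0)"

definition transport_plans ::
    "'a pair_pre_digraph \<Rightarrow> ('a \<Rightarrow> real) \<Rightarrow> ('a \<Rightarrow> real) \<Rightarrow> ('a \<Rightarrow> 'a \<Rightarrow> real) set" where
  "transport_plans G m1 m2 =
     {\<pi>. (\<forall>x \<in> pverts G. \<forall>y \<in> pverts G. 0 \<le> \<pi> x y \<and> \<pi> x y \<le> 1) \<and>
         (\<forall>x \<in> pverts G. (\<Sum>y \<in> pverts G. \<pi> x y) = m1 x) \<and>
         (\<forall>y \<in> pverts G. (\<Sum>x \<in> pverts G. \<pi> x y) = m2 y)}"

definition wasserstein :: "'a pair_pre_digraph \<Rightarrow> ('a \<Rightarrow> real) \<Rightarrow> ('a \<Rightarrow> real) \<Rightarrow> real" where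
  "wasserstein G m1 m2 =
     (INF \<pi> \<in> transport_plans G m1 m2.
        \<Sum>x \<in> pverts G. \<Sum>y \<in> pverts G. graph_dist G x y * \<pi> x y)"

definition ollivier_curvature :: "'a pair_pre_digraph \<Rightarrow> real \<Rightarrow> 'a \<Rightarrow> 'a \<Rightarrow> real" where
  "ollivier_curvature G p x y = 1 - wasserstein G (lazy_measure G p x) (lazy_measure G p y)"

text \<open>
  The idleness p ranges over [0, 1], so the limit for p tending to 1 is a limit from the left.
\<close>

definition lly_curvature :: "'a pair_pre_digraph \<Rightarrow> 'a \<Rightarrow> 'a \<Rightarrow> real" where
  "lly_curvature G x y = Lim (at_left 1) (\<lambda>p. ollivier_curvature G p x y / (1 - p))"

definition bonnet_myers_sharp :: "'a pair_pre_digraph \<Rightarrow> bool" where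
  "bonnet_myers_sharp G \<longleftrightarrow> (INF (x, y) \<in> parcs G. lly_curvature G x y) = 2 / diam G"

definition undirected_edges :: "'a pair_pre_digraph \<Rightarrow> 'a set set" where
  "undirected_edges G = {{u, v} | u v. (u, v) \<in> parcs G}"

definition matching :: "'a pair_pre_digraph \<Rightarrow> 'a set set \<Rightarrow> bool" where
  "matching G M \<longleftrightarrow> M \<subseteq> undirected_edges G \<and> pairwise disjnt M"

definition delete_edges :: "'a pair_pre_digraph \<Rightarrow> 'a set set \<Rightarrow> 'a pair_pre_digraph" where
  "delete_edges G M = G \<lparr> parcs := {(u, v) \<in> parcs G. {u, v} \<notin> M} \<rparr>"

end

(*
  The quotients kappa_p / (1 - p) increase with p and are bounded, so kappa_LLY is their supremum:
  a single idleness with one transport plan bounds it from below, and any 1-Lipschitz f with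
  f(y) - f(x) = 1 bounds it from above by Delta f(x) - Delta f(y).

  In diameter two, Bonnet-Myers sharpness means that all curvatures are at least 1, since
  f = d(x, _) along a geodesic x, y, z gives kappa(x, y) + kappa(y, z) <= 2.  If all curvatures
  are at least 1, the same f forces equality throughout: non-adjacent vertices have the same
  neighbours, and a neighbour of x has at most one neighbour outside the closed neighbourhood
  of x.  Hence every vertex has at most one non-neighbour.  Conversely, if this holds and
  d_y <= d_x, then at idleness 1 / (d_x + 1) only the mass on the non-neighbour of y has to
  move, over distance 1.
*)

theory Submission
  imports Defs "HOL-Analysis.Elementary_Topology"
begin

section \<open>Graph distance\<close>

context pair_graph
begin

lemma finite_nbrs [simp]: "finite {z. (x, z) \<in> parcs G}"
  by (rule finite_subset[OF _ pair_finite_verts]) (auto dest: in_arcsD2)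

lemma out_degree_eq_card_nbrs: "out_degree (with_proj G) x = card {z. (x, z) \<in> parcs G}"
proof -
  have "out_arcs (with_proj G) x = Pair x ` {z. (x, z) \<in> parcs G}"
    by (auto simp: out_arcs_def)
  then show ?thesis
    by (simp add: out_degree_def card_image inj_on_def)
qed

lemma out_degree_pos: "(x, y) \<in> parcs G \<Longrightarrow> 0 < out_degree (with_proj G) x"
  by (auto simp: out_degree_eq_card_nbrs card_gt_0_iff)

lemma awalk_cost_unit: "awalk_cost (\<lambda>_. 1) p = real (length p)"
  by (induction p) simp_all

lemma mu_unit_nonneg: "0 \<le> \<mu> (\<lambda>_. 1) u v"
  unfolding \<mu>_def by (rule INF_greatest) (simp add: awalk_cost_unit)

text \<open>Reversing a walk preserves its length, and the symmetry of the arcs makes the reversal a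
  walk.\<close>

lemma mu_unit_commute: "\<mu> (\<lambda>_. 1) u v = \<mu> (\<lambda>_. 1) v u"
proof -
  have len: "length (rev_path p) = length p" for p :: "('a \<times> 'a) list"
    by (induction p) simp_all
  have "\<mu> (\<lambda>_. 1) v u \<le> \<mu> (\<lambda>_. 1) u v" for u v
    unfolding \<mu>_def
  proof (rule INF_mono)
    fix p assume "p \<in> {p. awalk u p v}"
    then show "\<exists>q\<in>{p. awalk v p u}. ereal (awalk_cost (\<lambda>_. 1) q) \<le> ereal (awalk_cost (\<lambda>_. 1) p)"
      by (intro bexI[of _ "rev_path p"]) (simp_all add: awalk_cost_unit len)
  qed
  then show ?thesis by (simp add: antisym)
qed

lemma graph_dist_nonneg: "0 \<le> graph_dist G u v"
  unfolding graph_dist_def by (rule real_of_ereal_pos) (rule mu_unit_nonneg)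

lemma graph_dist_commute: "graph_dist G u v = graph_dist G v u"
  unfolding graph_dist_def by (subst mu_unit_commute) (rule refl)

lemma graph_dist_le_diam:
  assumes "u \<in> pverts G" "v \<in> pverts G"
  shows "graph_dist G u v \<le> diam G"
proof -
  have "bdd_above ((\<lambda>(x, y). graph_dist G x y) ` (pverts G \<times> pverts G))"
    by (intro bdd_above_finite finite_imageI finite_cartesian_product pair_finite_verts)
  from cSUP_upper[OF _ this, of "(u, v)"] assms show ?thesis
    unfolding diam_def by simp
qed

text \<open>Over finitely many pairs the supremum is a maximum. In diameter two this produces a pair
  at distance 2.\<close>

lemma diam_attained:
  assumes "pverts G \<noteq> {}"
  obtains u v where "u \<in> pverts G" "v \<in> pverts G" "graph_dist G u v = diam G"
proof -
  let ?D = "(\<lambda>(x, y). graph_dist G x y) ` (pverts G \<times> pverts G)"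
  have "finite ?D" "?D \<noteq> {}" using assms pair_finite_verts by auto
  then have "Max ?D \<in> ?D" "Sup ?D = Max ?D"
    by (auto intro: Max_in cSup_eq_Max)
  then show thesis using that unfolding diam_def by auto
qed

end

section \<open>Distances in connected graphs, realised by shortest walks\<close>

locale connected_pair_graph = pair_graph +
  assumes connected: "Digraph_Component.connected (with_proj G)"
begin

lemma pverts_nonempty: "pverts G \<noteq> {}"
  using connected by (simp add: connected_conv)

lemma ex_awalk:
  assumes "u \<in> pverts G" "v \<in> pverts G"
  shows "\<exists>p. awalk u p v"
proof -
  have "strongly_connected (with_proj G)"
    by (rule symmetric_connected_imp_strongly_connected) (use connected sym_arcs in auto)
  then have "u \<rightarrow>\<^sup>*\<^bsub>with_proj G\<^esub> v"
    using assms by (auto simp: strongly_connected_def)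
  then show ?thesis by (simp add: reachable_awalk)
qed

text \<open>\<open>real_of_ereal\<close> sends infinity to 0, so the real distance is faithful only
  where a walk exists; connectedness provides one.\<close>

lemma ereal_graph_dist:
  assumes "u \<in> pverts G" "v \<in> pverts G"
  shows "ereal (graph_dist G u v) = \<mu> (\<lambda>_. 1) u v"
proof -
  obtain p where "awalk u p v" using ex_awalk[OF assms] by blast
  from min_cost_le_walk_cost[OF this, of "\<lambda>_. 1"] mu_unit_nonneg[of u v]
  show ?thesis unfolding graph_dist_def by (cases "\<mu> (\<lambda>_. 1) u v") auto
qed

lemma graph_dist_le_length:
  assumes "awalk u p v"
  shows "graph_dist G u v \<le> length p"
proof -
  have "u \<in> pverts G" "v \<in> pverts G"
    using assms by auto
  from ereal_graph_dist[OF this] min_cost_le_walk_cost[OF assms, of "\<lambda>_. 1"]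
  show ?thesis by (metis awalk_cost_unit ereal_less_eq(3))
qed

text \<open>Walk lengths are natural numbers, so some walk has least length, and the infimum cannot
  lie below it.\<close>

lemma graph_dist_attained:
  assumes "u \<in> pverts G" "v \<in> pverts G"
  obtains p where "awalk u p v" "graph_dist G u v = length p"
proof -
  obtain p where p: "awalk u p v" "\<And>q. awalk u q v \<Longrightarrow> length p \<le> length q"
    using ex_has_least_nat[of "\<lambda>p. awalk u p v" _ length] ex_awalk[OF assms] by blast
  have "ereal (length p) \<le> \<mu> (\<lambda>_. 1) u v"
    unfolding \<mu>_def by (rule INF_greatest) (use p(2) in \<open>simp add: awalk_cost_unit\<close>)
  then have "real (length p) \<le> graph_dist G u v"
    by (simp flip: ereal_graph_dist[OF assms])
  with graph_dist_le_length[OF p(1)] show thesis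
    using that[OF p(1)] by simp
qed

lemma graph_dist_self: "u \<in> pverts G \<Longrightarrow> graph_dist G u u = 0"
  using graph_dist_le_length[of u "[]" u] graph_dist_nonneg[of u u]
  by (simp add: awalk_Nil_iff)

lemma graph_dist_ge_1:
  assumes "u \<in> pverts G" "v \<in> pverts G" "u \<noteq> v"
  shows "1 \<le> graph_dist G u v"
proof -
  obtain p where p: "awalk u p v" "graph_dist G u v = length p"
    using graph_dist_attained[OF assms(1,2)] .
  with \<open>u \<noteq> v\<close> show ?thesis by (cases p) (auto simp: awalk_Nil_iff)
qed

lemma graph_dist_arc:
  assumes "(u, v) \<in> parcs G"
  shows "graph_dist G u v = 1"
proof (rule antisym)
  show "1 \<le> graph_dist G u v"
    using assms by (intro graph_dist_ge_1) (auto dest: in_arcsD1 in_arcsD2 no_loops')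
  show "graph_dist G u v \<le> 1"
    using graph_dist_le_length[of u "[(u, v)]" v] assms
    by (auto simp: awalk_simps dest: in_arcsD2)
qed

lemma graph_dist_ge_2:
  assumes "u \<in> pverts G" "v \<in> pverts G" "u \<noteq> v" "(u, v) \<notin> parcs G"
  shows "2 \<le> graph_dist G u v"
proof -
  obtain p where p: "awalk u p v" "graph_dist G u v = length p"
    using graph_dist_attained[OF assms(1,2)] .
  with assms(3,4) have "p \<noteq> []" "\<And>e. p \<noteq> [e]"
    by (auto simp: awalk_simps)
  then have "2 \<le> length p"
    by (cases p; cases "tl p") auto
  with p show ?thesis by simp
qed

lemma graph_dist_triangle:
  assumes "u \<in> pverts G" "v \<in> pverts G" "w \<in> pverts G"
  shows "graph_dist G u w \<le> graph_dist G u v + graph_dist G v w"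
proof -
  obtain p where p: "awalk u p v" "graph_dist G u v = length p"
    using graph_dist_attained[OF assms(1,2)] .
  obtain q where q: "awalk v q w" "graph_dist G v w = length q"
    using graph_dist_attained[OF assms(2,3)] .
  from graph_dist_le_length[OF awalk_appendI[OF p(1) q(1)]] p(2) q(2)
  show ?thesis by simp
qed

lemma graph_dist_2_common_nbr:
  assumes "u \<in> pverts G" "v \<in> pverts G" "graph_dist G u v = 2"
  obtains y where "(u, y) \<in> parcs G" "(y, v) \<in> parcs G"
proof -
  obtain p where p: "awalk u p v" "graph_dist G u v = length p"
    using graph_dist_attained[OF assms(1,2)] .
  then have "length p = Suc (Suc 0)" using assms(3) by simp
  then obtain e e' where "p = [e, e']" by (auto simp: length_Suc_conv)
  with p have "e = (u, snd e)" "e' = (snd e, v)" "e \<in> parcs G" "e' \<in> parcs G"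
    by (auto simp: awalk_simps prod_eq_iff)
  then show thesis using that by metis
qed

end


section \<open>Lazy random walks and the Wasserstein distance\<close>

text \<open>The random walk Laplacian, with the sign that makes it nonpositive where
  \<open>f\<close> has a maximum.\<close>

definition graph_laplacian :: "'a pair_pre_digraph \<Rightarrow> ('a \<Rightarrow> real) \<Rightarrow> 'a \<Rightarrow> real" where
  "graph_laplacian G f x =
     (\<Sum>z | (x, z) \<in> parcs G. f z - f x) / real (out_degree (with_proj G) x)"

definition transport_cost :: "'a pair_pre_digraph \<Rightarrow> ('a \<Rightarrow> 'a \<Rightarrow> real) \<Rightarrow> real" where
  "transport_cost G \<pi> = (\<Sum>x \<in> pverts G. \<Sum>y \<in> pverts G. graph_dist G x y * \<pi> x y)"

text \<open>
  The common mass stays where it is and the excess of the first measure is spread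
  proportionally to that of the second.  For equal measures the divisor is zero, but then so is
  the numerator.
\<close>

definition excess_plan ::
    "'a pair_pre_digraph \<Rightarrow> ('a \<Rightarrow> real) \<Rightarrow> ('a \<Rightarrow> real) \<Rightarrow> 'a \<Rightarrow> 'a \<Rightarrow> real" where
  "excess_plan G m1 m2 v w =
     (if v = w then min (m1 v) (m2 v) else 0) +
     max 0 (m1 v - m2 v) * max 0 (m2 w - m1 w) / (\<Sum>z \<in> pverts G. max 0 (m1 z - m2 z))"

text \<open>The positive and negative parts of \<open>f - g\<close> differ by \<open>f - g\<close>,
  whose sum vanishes.\<close>

lemma sum_excess_eq:
  fixes f g :: "'a \<Rightarrow> real"
  assumes "sum f A = sum g A"
  shows "(\<Sum>z \<in> A. max 0 (f z - g z)) = (\<Sum>z \<in> A. max 0 (g z - f z))"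
proof -
  have "(\<Sum>z \<in> A. max 0 (f z - g z)) - (\<Sum>z \<in> A. max 0 (g z - f z)) = (\<Sum>z \<in> A. f z - g z)"
    unfolding sum_subtractf[symmetric] by (rule sum.cong) auto
  with assms show ?thesis by (simp add: sum_subtractf)
qed

context pair_graph
begin

text \<open>Expectations under the lazy measure are affine in \<open>p\<close>. This turns duality
  bounds into differences of Laplacians, and constant \<open>f = 1\<close> gives total mass 1. The
  arc makes the degree positive.\<close>

lemma sum_lazy_measure:
  assumes "(x, y) \<in> parcs G"
  shows "(\<Sum>z \<in> pverts G. f z * lazy_measure G p x z) = f x + (1 - p) * graph_laplacian G f x"
proof -
  let ?N = "{z. (x, z) \<in> parcs G}"
  define D where "D = real (out_degree (with_proj G) x)"
  have D: "D = real (card ?N)" "D > 0"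
    using out_degree_pos[OF assms] by (simp_all add: D_def out_degree_eq_card_nbrs)
  have x: "x \<notin> ?N" "x \<in> pverts G"
    using assms by (auto dest: no_loops' in_arcsD1)
  have "(\<Sum>z \<in> pverts G. f z * lazy_measure G p x z) = (\<Sum>z \<in> insert x ?N. f z * lazy_measure G p x z)"
    by (rule sum.mono_neutral_right)
       (use x in \<open>auto simp: lazy_measure_def pair_finite_verts dest: in_arcsD2\<close>)
  also have "\<dots> = f x * p + (\<Sum>z \<in> ?N. f z * lazy_measure G p x z)"
    using x by (simp add: lazy_measure_def)
  also have "(\<Sum>z \<in> ?N. f z * lazy_measure G p x z) = (\<Sum>z \<in> ?N. f z * ((1 - p) / D))"
    by (rule sum.cong) (use x in \<open>auto simp: lazy_measure_def D_def\<close>)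
  also have "\<dots> = (1 - p) / D * (\<Sum>z \<in> ?N. f z)"
    by (simp add: sum_distrib_left mult.commute)
  also have "(\<Sum>z \<in> ?N. f z) = (\<Sum>z \<in> ?N. f z - f x) + D * f x"
    by (simp add: sum_subtractf D)
  also have "f x * p + (1 - p) / D * ((\<Sum>z \<in> ?N. f z - f x) + D * f x)
      = f x + (1 - p) * graph_laplacian G f x"
    unfolding graph_laplacian_def D_def[symmetric] using \<open>D > 0\<close> by (simp add: field_simps)
  finally show ?thesis .
qed

lemma lazy_measure_nonneg: "0 \<le> p \<Longrightarrow> p \<le> 1 \<Longrightarrow> 0 \<le> lazy_measure G p x z"
  by (simp add: lazy_measure_def)

lemma sum_lazy_measure_1:
  assumes "(x, y) \<in> parcs G"
  shows "(\<Sum>z \<in> pverts G. lazy_measure G p x z) = 1"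
  using sum_lazy_measure[OF assms, of "\<lambda>_. 1" p] by (simp add: graph_laplacian_def)

lemma transport_cost_nonneg: "\<pi> \<in> transport_plans G m1 m2 \<Longrightarrow> 0 \<le> transport_cost G \<pi>"
  unfolding transport_cost_def transport_plans_def
  by (auto intro!: sum_nonneg mult_nonneg_nonneg graph_dist_nonneg)

lemma wasserstein_le:
  assumes "\<pi> \<in> transport_plans G m1 m2"
  shows "wasserstein G m1 m2 \<le> transport_cost G \<pi>"
proof -
  have "bdd_below (transport_cost G ` transport_plans G m1 m2)"
    by (rule bdd_belowI[of _ 0]) (auto intro: transport_cost_nonneg)
  from cINF_lower[OF this assms] show ?thesis
    by (simp add: wasserstein_def transport_cost_def[abs_def])
qed

lemma wasserstein_ge:
  assumes "transport_plans G m1 m2 \<noteq> {}"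
    and "\<And>\<pi>. \<pi> \<in> transport_plans G m1 m2 \<Longrightarrow> c \<le> transport_cost G \<pi>"
  shows "c \<le> wasserstein G m1 m2"
  using cINF_greatest[OF assms] by (simp add: wasserstein_def transport_cost_def[abs_def])

lemma transport_plans_transpose:
  "\<pi> \<in> transport_plans G m1 m2 \<Longrightarrow> (\<lambda>u v. \<pi> v u) \<in> transport_plans G m2 m1"
  by (auto simp: transport_plans_def)

lemma transport_cost_transpose: "transport_cost G (\<lambda>u v. \<pi> v u) = transport_cost G \<pi>"
  unfolding transport_cost_def
  by (subst sum.swap) (simp add: graph_dist_commute)

lemma wasserstein_commute: "wasserstein G m1 m2 = wasserstein G m2 m1"
proof -
  have "transport_cost G ` transport_plans G m1 m2 \<subseteq> transport_cost G ` transport_plans G m2 m1" for m1 m2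
    using transport_plans_transpose transport_cost_transpose by (metis image_eqI image_subsetI)
  then have "transport_cost G ` transport_plans G m1 m2 = transport_cost G ` transport_plans G m2 m1"
    by (rule antisym) fact
  then show ?thesis
    by (simp add: wasserstein_def transport_cost_def[abs_def])
qed

text \<open>Plans can be transposed at equal cost. This later allows the endpoint of larger degree
  to come first.\<close>

lemma lly_curvature_commute: "lly_curvature G x y = lly_curvature G y x"
  by (simp add: lly_curvature_def ollivier_curvature_def
      wasserstein_commute[of "lazy_measure G _ x" "lazy_measure G _ y"])

text \<open>A row adds to the common mass the excess of \<open>m1\<close> times total deficit over
  total excess, a ratio of 1; columns are dual. The plan also witnesses that transport plans
  exist.\<close>

lemma excess_plan_in_transport_plans:
  assumes nn: "\<And>v. v \<in> pverts G \<Longrightarrow> 0 \<le> m1 v" "\<And>v. v \<in> pverts G \<Longrightarrow> 0 \<le> m2 v"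
    and sums: "(\<Sum>v \<in> pverts G. m1 v) = 1" "(\<Sum>v \<in> pverts G. m2 v) = 1"
  shows "excess_plan G m1 m2 \<in> transport_plans G m1 m2"
proof -
  let ?V = "pverts G"
  let ?a = "\<lambda>v. max 0 (m1 v - m2 v)" and ?b = "\<lambda>v. max 0 (m2 v - m1 v)"
  define s where "s = (\<Sum>z \<in> ?V. ?a z)"
  have fin: "finite ?V" by (rule pair_finite_verts)
  have sb: "(\<Sum>z \<in> ?V. ?b z) = s"
    using sums sum_excess_eq[of m1 ?V m2] by (simp add: s_def)
  have s_nn: "0 \<le> s" unfolding s_def by (rule sum_nonneg) simp
  \<comment> \<open>For \<open>s = 0\<close> the quotients by \<open>s\<close> are 0 by convention;
    the marginals still come out because all excesses vanish too.\<close>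
  have a0: "?a v = 0" and b0: "?b v = 0" if "s = 0" "v \<in> ?V" for v
    using that sb fin sum_nonneg_eq_0_iff[OF fin, of ?a] sum_nonneg_eq_0_iff[OF fin, of ?b]
    by (auto simp: s_def)
  have plan: "excess_plan G m1 m2 v w = (if v = w then min (m1 v) (m2 v) else 0) + ?a v * ?b w / s" for v w
    by (simp add: excess_plan_def s_def)
  have row: "(\<Sum>w \<in> ?V. excess_plan G m1 m2 v w) = m1 v" if "v \<in> ?V" for v
  proof -
    have "(\<Sum>w \<in> ?V. excess_plan G m1 m2 v w)
        = min (m1 v) (m2 v) + ?a v * (\<Sum>w \<in> ?V. ?b w) / s"
      using that fin by (simp add: plan sum.distrib sum_distrib_left sum_divide_distrib)
    also have "\<dots> = min (m1 v) (m2 v) + ?a v"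
      using a0[OF _ that] by (cases "s = 0") (simp_all add: sb)
    finally show ?thesis by simp
  qed
  have col: "(\<Sum>v \<in> ?V. excess_plan G m1 m2 v w) = m2 w" if "w \<in> ?V" for w
  proof -
    have "(\<Sum>v \<in> ?V. excess_plan G m1 m2 v w)
        = min (m1 w) (m2 w) + s * ?b w / s"
      using that fin by (simp add: plan sum.distrib sum_distrib_right sum_divide_distrib s_def)
    also have "\<dots> = min (m1 w) (m2 w) + ?b w"
      using b0[OF _ that] by (cases "s = 0") simp_all
    finally show ?thesis by simp
  qed
  have pos: "0 \<le> excess_plan G m1 m2 v w" if "v \<in> ?V" "w \<in> ?V" for v w
    unfolding plan using that nn s_nn
    by (intro add_nonneg_nonneg divide_nonneg_nonneg mult_nonneg_nonneg) simp_all
  \<comment> \<open>An entry is at most its row sum, which is at most the total mass 1.\<close>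
  have "excess_plan G m1 m2 v w \<le> 1" if "v \<in> ?V" "w \<in> ?V" for v w
  proof -
    have "excess_plan G m1 m2 v w \<le> m1 v"
      unfolding row[OF that(1), symmetric]
      by (rule member_le_sum) (use that pos fin in auto)
    also have "m1 v \<le> (\<Sum>v \<in> ?V. m1 v)"
      by (rule member_le_sum) (use that nn fin in auto)
    finally show ?thesis using sums by simp
  qed
  then show ?thesis
    using row col pos by (simp add: transport_plans_def)
qed

lemma lazy_transport_plans_nonempty:
  assumes "(x, y) \<in> parcs G" "0 \<le> p" "p \<le> 1"
  shows "transport_plans G (lazy_measure G p x) (lazy_measure G p y) \<noteq> {}"
  using excess_plan_in_transport_plans[of "lazy_measure G p x" "lazy_measure G p y"]
    sum_lazy_measure_1[OF assms(1)] sum_lazy_measure_1[OF arcs_symmetric[OF assms(1)]] assms(2,3)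
  by (auto intro: lazy_measure_nonneg)

lemma sum_marginals:
  assumes "\<pi> \<in> transport_plans G m1 m2"
  shows "(\<Sum>u \<in> pverts G. \<Sum>v \<in> pverts G. f u * \<pi> u v) = (\<Sum>u \<in> pverts G. f u * m1 u)"
    and "(\<Sum>u \<in> pverts G. \<Sum>v \<in> pverts G. f v * \<pi> u v) = (\<Sum>v \<in> pverts G. f v * m2 v)"
proof -
  show "(\<Sum>u \<in> pverts G. \<Sum>v \<in> pverts G. f u * \<pi> u v) = (\<Sum>u \<in> pverts G. f u * m1 u)"
    using assms by (simp add: transport_plans_def flip: sum_distrib_left)
  show "(\<Sum>u \<in> pverts G. \<Sum>v \<in> pverts G. f v * \<pi> u v) = (\<Sum>v \<in> pverts G. f v * m2 v)"
    using assms by (subst sum.swap) (simp add: transport_plans_def flip: sum_distrib_left)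
qed

text \<open>The easy half of Kantorovich duality.\<close>

lemma transport_cost_ge_lipschitz:
  assumes \<pi>: "\<pi> \<in> transport_plans G m1 m2"
    and lip: "\<And>u v. u \<in> pverts G \<Longrightarrow> v \<in> pverts G \<Longrightarrow> f v - f u \<le> graph_dist G u v"
  shows "(\<Sum>v \<in> pverts G. f v * m2 v) - (\<Sum>v \<in> pverts G. f v * m1 v) \<le> transport_cost G \<pi>"
proof -
  have "(\<Sum>u \<in> pverts G. \<Sum>v \<in> pverts G. (f v - f u) * \<pi> u v) \<le> transport_cost G \<pi>"
    unfolding transport_cost_def
    by (intro sum_mono mult_right_mono lip) (use \<pi> in \<open>auto simp: transport_plans_def\<close>)
  then show ?thesis
    by (simp add: left_diff_distrib sum_subtractf sum_marginals[OF \<pi>])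
qed

text \<open>The common mass is free, and all other mass goes from an excess point to a deficit
  point, over distance at most 1 by \<open>near\<close>. So the cost is at most the amount
  moved.\<close>

lemma transport_cost_excess_plan:
  assumes sums: "(\<Sum>v \<in> pverts G. m1 v) = (\<Sum>v \<in> pverts G. m2 v)"
    and self: "\<And>v. v \<in> pverts G \<Longrightarrow> graph_dist G v v = 0"
    and near: "\<And>v w. v \<in> pverts G \<Longrightarrow> w \<in> pverts G \<Longrightarrow> m2 v < m1 v \<Longrightarrow> m1 w < m2 w
      \<Longrightarrow> graph_dist G v w \<le> 1"
  shows "transport_cost G (excess_plan G m1 m2) \<le> (\<Sum>v \<in> pverts G. max 0 (m1 v - m2 v))"
proof -
  let ?V = "pverts G"
  let ?a = "\<lambda>v. max 0 (m1 v - m2 v)" and ?b = "\<lambda>v. max 0 (m2 v - m1 v)"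
  define s where "s = (\<Sum>z \<in> ?V. ?a z)"
  have sb: "(\<Sum>z \<in> ?V. ?b z) = s"
    using sums sum_excess_eq[of m1 ?V m2] by (simp add: s_def)
  have s_nn: "0 \<le> s" unfolding s_def by (rule sum_nonneg) simp
  have "transport_cost G (excess_plan G m1 m2) \<le> (\<Sum>v \<in> ?V. \<Sum>w \<in> ?V. ?a v * ?b w / s)"
    unfolding transport_cost_def
  proof (intro sum_mono)
    fix v w assume vw: "v \<in> ?V" "w \<in> ?V"
    \<comment> \<open>On the diagonal the distance is 0; off it the common mass term is
      absent.\<close>
    have "graph_dist G v w * excess_plan G m1 m2 v w = graph_dist G v w * (?a v * ?b w / s)"
      using self[OF vw(1)] by (cases "v = w") (simp_all add: excess_plan_def s_def)
    also have "\<dots> \<le> 1 * (?a v * ?b w / s)"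
    proof (cases "m2 v < m1 v \<and> m1 w < m2 w")
      case True
      then show ?thesis
        by (intro mult_right_mono near vw) (use s_nn in auto)
    next
      case False
      then have "?a v * ?b w = 0" by auto
      then show ?thesis by (simp only: div_0 mult_zero_right order_refl)
    qed
    finally show "graph_dist G v w * excess_plan G m1 m2 v w \<le> ?a v * ?b w / s" by simp
  qed
  also have "\<dots> = s * s / s"
    by (simp add: sb flip: sum_product sum_divide_distrib s_def)
  also have "\<dots> = s" by simp
  finally show ?thesis by (simp add: s_def)
qed

text \<open>A convex combination with the plan that carries a unit mass from \<open>x\<close> to
  \<open>y\<close>. Nested conditionals let sums collapse one index at a time.\<close>

definition mix_point_plan :: "real \<Rightarrow> 'a \<Rightarrow> 'a \<Rightarrow> ('a \<Rightarrow> 'a \<Rightarrow> real) \<Rightarrow> 'a \<Rightarrow> 'a \<Rightarrow> real" where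
  "mix_point_plan t x y \<pi> u v = t * \<pi> u v + (if u = x then if v = y then 1 - t else 0 else 0)"

lemma mix_point_plan:
  assumes \<pi>: "\<pi> \<in> transport_plans G m1 m2"
    and V: "x \<in> pverts G" "y \<in> pverts G" and t: "0 \<le> t" "t \<le> 1"
  shows "mix_point_plan t x y \<pi> \<in> transport_plans G
    (\<lambda>v. t * m1 v + (if v = x then 1 - t else 0)) (\<lambda>v. t * m2 v + (if v = y then 1 - t else 0))"
proof -
  have "0 \<le> mix_point_plan t x y \<pi> u v \<and> mix_point_plan t x y \<pi> u v \<le> 1"
    if "u \<in> pverts G" "v \<in> pverts G" for u v
  proof -
    have b: "0 \<le> \<pi> u v" "\<pi> u v \<le> 1"
      using \<pi> that by (auto simp: transport_plans_def)
    \<comment> \<open>The bound \<open>t\<close>, sharper than 1, leaves room for the extra mass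
      \<open>1 - t\<close> at \<open>(x, y)\<close>.\<close>
    have "t * \<pi> u v \<le> t * 1" by (rule mult_left_mono) (use b t in auto)
    then have "t * \<pi> u v \<le> t" by simp
    moreover from this have "t * \<pi> u v \<le> 1" using t(2) by linarith
    moreover have "0 \<le> t * \<pi> u v" using b t by simp
    ultimately show ?thesis
      unfolding mix_point_plan_def using t(2)
      by (cases "u = x"; cases "v = y") (simp_all only: if_True if_False simp_thms add_0_right, linarith+)
  qed
  moreover have "(\<Sum>v \<in> pverts G. mix_point_plan t x y \<pi> u v) = t * m1 u + (if u = x then 1 - t else 0)"
    if "u \<in> pverts G" for u
  proof -
    have "m1 u = (\<Sum>v \<in> pverts G. \<pi> u v)" using \<pi> that by (simp add: transport_plans_def)
    then show ?thesis
      using V pair_finite_verts by (simp add: mix_point_plan_def sum.distrib sum_distrib_left)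
  qed
  moreover have "(\<Sum>u \<in> pverts G. mix_point_plan t x y \<pi> u v) = t * m2 v + (if v = y then 1 - t else 0)"
    if "v \<in> pverts G" for v
  proof -
    have "m2 v = (\<Sum>u \<in> pverts G. \<pi> u v)" using \<pi> that by (simp add: transport_plans_def)
    then show ?thesis
      using V pair_finite_verts
      by (cases "v = y") (simp_all add: mix_point_plan_def sum.distrib sum_distrib_left)
  qed
  ultimately show ?thesis unfolding transport_plans_def by blast
qed

lemma transport_cost_mix_point_plan:
  assumes V: "x \<in> pverts G" "y \<in> pverts G"
  shows "transport_cost G (mix_point_plan t x y \<pi>) = t * transport_cost G \<pi> + graph_dist G x y * (1 - t)"
proof -
  let ?c = "graph_dist G x y * (1 - t)"
  have "transport_cost G (mix_point_plan t x y \<pi>) = t * transport_cost G \<pi> +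
     (\<Sum>u \<in> pverts G. \<Sum>v \<in> pverts G. if u = x then if v = y then ?c else 0 else 0)"
    unfolding transport_cost_def sum_distrib_left sum.distrib[symmetric]
    by (intro sum.cong refl) (simp add: mix_point_plan_def distrib_left)
  also have "(\<Sum>u \<in> pverts G. \<Sum>v \<in> pverts G. if u = x then if v = y then ?c else 0 else 0)
      = (\<Sum>u \<in> pverts G. if u = x then ?c else 0)"
    using V pair_finite_verts by (intro sum.cong refl) simp
  also have "\<dots> = ?c" using V pair_finite_verts by simp
  finally show ?thesis .
qed


section \<open>Curvature\<close>

text \<open>By duality the Wasserstein distance is at least the difference of the expectations of
  \<open>f\<close>. This is 1 plus \<open>1 - p\<close> times a difference of Laplacians, and the 1
  cancels in the curvature.\<close>

lemma ollivier_curvature_le_lipschitz: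
  assumes xy: "(x, y) \<in> parcs G" and p: "0 \<le> p" "p \<le> 1"
    and lip: "\<And>u v. u \<in> pverts G \<Longrightarrow> v \<in> pverts G \<Longrightarrow> f v - f u \<le> graph_dist G u v"
    and f: "f y - f x = 1"
  shows "ollivier_curvature G p x y \<le> (1 - p) * (graph_laplacian G f x - graph_laplacian G f y)"
proof -
  let ?m = "lazy_measure G p"
  have "(\<Sum>v \<in> pverts G. f v * ?m y v) - (\<Sum>v \<in> pverts G. f v * ?m x v) \<le> wasserstein G (?m x) (?m y)"
    by (intro wasserstein_ge lazy_transport_plans_nonempty transport_cost_ge_lipschitz xy p lip)
  then show ?thesis
    using f unfolding ollivier_curvature_def sum_lazy_measure[OF xy]
      sum_lazy_measure[OF arcs_symmetric[OF xy]]
    by (simp add: algebra_simps)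
qed

end

context connected_pair_graph
begin

text \<open>
  The lazy measure at the larger idleness \<open>p\<close> is a convex combination of the one at \<open>q\<close> and a
  point mass, and transporting the point mass costs \<open>d(x, y) = 1\<close>.
\<close>

lemma ollivier_curvature_quotient_mono:
  assumes xy: "(x, y) \<in> parcs G" and q: "0 \<le> q" "q \<le> p" "p < 1"
  shows "ollivier_curvature G q x y / (1 - q) \<le> ollivier_curvature G p x y / (1 - p)"
proof -
  \<comment> \<open>Scaling the mass on the neighbours from idleness \<open>q\<close> to idleness
    \<open>p\<close> forces this weight.\<close>
  define t where "t = (1 - p) / (1 - q)"
  have t: "0 < t" "t \<le> 1" "t * (1 - q) = 1 - p"
    using q by (simp_all add: t_def field_simps)
  then have p_eq: "p = t * q + (1 - t)" by (simp add: algebra_simps)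
  have conv: "lazy_measure G p z v = t * lazy_measure G q z v + (if v = z then 1 - t else 0)" for z v
    using p_eq t(3) by (simp add: lazy_measure_def)
  have V: "x \<in> pverts G" "y \<in> pverts G" using xy by (auto dest: in_arcsD1 in_arcsD2)
  note fin = pair_finite_verts
  have m: "lazy_measure G p z = (\<lambda>v. t * lazy_measure G q z v + (if v = z then 1 - t else 0))" for z
    by (rule ext) (rule conv)
  let ?Wp = "wasserstein G (lazy_measure G p x) (lazy_measure G p y)"
  have "(?Wp - (1 - t)) / t \<le> wasserstein G (lazy_measure G q x) (lazy_measure G q y)"
  proof (rule wasserstein_ge)
    show "transport_plans G (lazy_measure G q x) (lazy_measure G q y) \<noteq> {}"
      by (rule lazy_transport_plans_nonempty) (use xy q in auto)
    fix \<pi> assume "\<pi> \<in> transport_plans G (lazy_measure G q x) (lazy_measure G q y)"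
    from mix_point_plan[OF this V] t(1,2)
    have "mix_point_plan t x y \<pi> \<in> transport_plans G (lazy_measure G p x) (lazy_measure G p y)"
      unfolding m by simp
    from wasserstein_le[OF this] have "?Wp \<le> t * transport_cost G \<pi> + (1 - t)"
      by (simp add: transport_cost_mix_point_plan[OF V] graph_dist_arc[OF xy])
    then show "(?Wp - (1 - t)) / t \<le> transport_cost G \<pi>"
      using t(1) by (simp add: pos_divide_le_eq mult.commute)
  qed
  then have "?Wp - (1 - t) \<le> t * wasserstein G (lazy_measure G q x) (lazy_measure G q y)"
    using t(1) by (simp add: pos_divide_le_eq mult.commute)
  then have "t * ollivier_curvature G q x y \<le> ollivier_curvature G p x y"
    by (simp add: ollivier_curvature_def right_diff_distrib)
  then have "t * ollivier_curvature G q x y / (1 - p) \<le> ollivier_curvature G p x y / (1 - p)"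
    using q by (intro divide_right_mono) auto
  moreover have "t * ollivier_curvature G q x y / (1 - p) = ollivier_curvature G q x y / (1 - q)"
    using q by (simp add: t_def)
  ultimately show ?thesis by simp
qed


lemma lipschitz_graph_dist:
  assumes "x \<in> pverts G" "u \<in> pverts G" "v \<in> pverts G"
  shows "graph_dist G x v - graph_dist G x u \<le> graph_dist G u v"
  using graph_dist_triangle[OF assms] by simp

lemma ollivier_curvature_quotient_le:
  assumes "(x, y) \<in> parcs G" "0 \<le> p" "p < 1"
    and "\<And>u v. u \<in> pverts G \<Longrightarrow> v \<in> pverts G \<Longrightarrow> f v - f u \<le> graph_dist G u v"
    and "f y - f x = 1"
  shows "ollivier_curvature G p x y / (1 - p) \<le> graph_laplacian G f x - graph_laplacian G f y"
  using ollivier_curvature_le_lipschitz[of x y p f] assms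
  by (simp add: pos_divide_le_eq mult.commute)

text \<open>\<open>graph_dist G x\<close> is 1-Lipschitz and grows by 1 along the edge; its
  Laplacians do not involve \<open>p\<close>, so the bound is uniform.\<close>

lemma bdd_above_ollivier_curvature_quotient:
  assumes "(x, y) \<in> parcs G"
  shows "bdd_above ((\<lambda>p. ollivier_curvature G p x y / (1 - p)) ` {0..<1})"
proof -
  have x: "x \<in> pverts G" using assms by (rule in_arcsD1)
  show ?thesis
    by (rule bdd_aboveI, erule imageE, erule ssubst, rule ollivier_curvature_quotient_le[OF assms])
       (auto simp: graph_dist_arc[OF assms] graph_dist_self[OF x] intro: lipschitz_graph_dist[OF x])
qed

text \<open>A bounded increasing function tends to its supremum from the left. Curvature bounds thus
  reduce to bounds at fixed idleness.\<close>

lemma lly_curvature_eq_SUP: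
  assumes "(x, y) \<in> parcs G"
  shows "lly_curvature G x y = (SUP p\<in>{0..<1}. ollivier_curvature G p x y / (1 - p))"
proof -
  let ?g = "\<lambda>p. ollivier_curvature G p x y / (1 - p)"
  obtain K where K: "\<And>p. 0 \<le> p \<Longrightarrow> p < 1 \<Longrightarrow> ?g p \<le> K"
    using bdd_above_ollivier_curvature_quotient[OF assms] unfolding bdd_above_def by fastforce
  have "(?g \<longlongrightarrow> Sup (?g ` ({..<1} \<inter> {0..}))) (at 1 within ({..<1} \<inter> {0..}))"
    by (rule Lim_left_bound) (auto intro: ollivier_curvature_quotient_mono[OF assms] K)
  moreover have "{..<1} \<inter> {0..} = {0..<1::real}" by auto
  \<comment> \<open>Near 1 the constraint \<open>0 \<le> p\<close>, which monotonicity requires,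
    holds automatically.\<close>
  moreover have "at 1 within {0..<1} = at_left (1::real)"
    by (rule at_within_nhd[of _ "{0<..}"]) auto
  ultimately have "(?g \<longlongrightarrow> (SUP p\<in>{0..<1}. ?g p)) (at_left 1)" by simp
  then show ?thesis
    unfolding lly_curvature_def by (rule tendsto_Lim[OF trivial_limit_at_left_real])
qed

lemma lly_curvature_ge:
  assumes "(x, y) \<in> parcs G" "0 \<le> p" "p < 1"
  shows "ollivier_curvature G p x y / (1 - p) \<le> lly_curvature G x y"
  unfolding lly_curvature_eq_SUP[OF assms(1)]
  by (rule cSUP_upper[OF _ bdd_above_ollivier_curvature_quotient[OF assms(1)]]) (use assms in simp)

lemma lly_curvature_le_lipschitz:
  assumes "(x, y) \<in> parcs G"
    and "\<And>u v. u \<in> pverts G \<Longrightarrow> v \<in> pverts G \<Longrightarrow> f v - f u \<le> graph_dist G u v"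
    and "f y - f x = 1"
  shows "lly_curvature G x y \<le> graph_laplacian G f x - graph_laplacian G f y"
  unfolding lly_curvature_eq_SUP[OF assms(1)]
  by (rule cSUP_least) (use assms in \<open>auto intro: ollivier_curvature_quotient_le\<close>)

end


section \<open>Diameter two\<close>

locale diam2_graph = connected_pair_graph +
  assumes diam_eq: "diam G = 2"
begin

section \<open>Distances and Laplacians of distance functions in diameter two\<close>

lemma graph_dist_eq:
  assumes "u \<in> pverts G" "v \<in> pverts G"
  shows "graph_dist G u v = (if u = v then 0 else if (u, v) \<in> parcs G then 1 else 2)"
  using graph_dist_self[OF assms(1)] graph_dist_arc[of u v] graph_dist_ge_2[OF assms]
    graph_dist_le_diam[OF assms] diam_eq by auto

lemma ex_nonadjacent:
  obtains x z where "x \<in> pverts G" "z \<in> pverts G" "x \<noteq> z" "(x, z) \<notin> parcs G"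
proof -
  obtain x z where "x \<in> pverts G" "z \<in> pverts G" "graph_dist G x z = 2"
    using diam_attained[OF pverts_nonempty] diam_eq by metis
  with that show thesis by (auto simp: graph_dist_eq split: if_splits)
qed

lemma common_nbr:
  assumes "x \<in> pverts G" "z \<in> pverts G" "x \<noteq> z" "(x, z) \<notin> parcs G"
  obtains y where "(x, y) \<in> parcs G" "(y, z) \<in> parcs G"
  using graph_dist_2_common_nbr[OF assms(1,2)] assms by (auto simp: graph_dist_eq)

lemma graph_laplacian_dist_self:
  assumes "(x, y) \<in> parcs G"
  shows "graph_laplacian G (graph_dist G x) x = 1"
proof -
  have "x \<in> pverts G" using assms by (rule in_arcsD1)
  then have "(\<Sum>z | (x, z) \<in> parcs G. graph_dist G x z - graph_dist G x x)
      = (\<Sum>z | (x, z) \<in> parcs G. 1)"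
    by (intro sum.cong) (auto simp: graph_dist_arc graph_dist_self)
  then show ?thesis
    using out_degree_pos[OF assms]
    by (simp add: graph_laplacian_def flip: out_degree_eq_card_nbrs)
qed

text \<open>At a vertex \<open>z\<close> not adjacent to \<open>x\<close>, \<open>d(x, _)\<close> drops by one exactly at the common neighbours.\<close>

lemma graph_laplacian_dist_nonadjacent:
  assumes xz: "x \<in> pverts G" "z \<in> pverts G" "x \<noteq> z" "(x, z) \<notin> parcs G"
  shows "- 1 \<le> graph_laplacian G (graph_dist G x) z"
    and "graph_laplacian G (graph_dist G x) z \<le> - 1 \<Longrightarrow> (z, w) \<in> parcs G \<Longrightarrow> (x, w) \<in> parcs G"
proof -
  let ?N = "{w. (z, w) \<in> parcs G}" and ?f = "graph_dist G x"
  obtain y where y: "(z, y) \<in> parcs G"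
    using common_nbr[OF xz] arcs_symmetric by blast
  define k where "k = real (card ?N)"
  have k: "0 < k"
    using out_degree_pos[OF y] by (simp add: k_def flip: out_degree_eq_card_nbrs)
  \<comment> \<open>Neighbours of \<open>z\<close> differ from \<open>x\<close>, so they lie at
    distance 1 or 2 from it, and \<open>?f w - 1\<close> indicates non-adjacency to
    \<open>x\<close>.\<close>
  have f: "?f w - 1 = (if (x, w) \<in> parcs G then 0 else 1)" if "w \<in> ?N" for w
  proof -
    have "w \<in> pverts G" "x \<noteq> w" using that xz(4) by (auto dest: in_arcsD2 arcs_symmetric)
    then show ?thesis using graph_dist_eq[OF xz(1)] by simp
  qed
  have nn: "0 \<le> ?f w - 1" if "w \<in> ?N" for w using f[OF that] by simp
  have "graph_laplacian G ?f z = (\<Sum>w \<in> ?N. (?f w - 1) - 1) / k"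
    using graph_dist_eq[OF xz(1,2)] xz by (simp add: graph_laplacian_def out_degree_eq_card_nbrs k_def)
  also have "\<dots> = (\<Sum>w \<in> ?N. ?f w - 1) / k - 1"
    unfolding sum_subtractf[of "\<lambda>w. ?f w - 1"] using k by (simp add: diff_divide_distrib k_def[symmetric])
  finally have L: "graph_laplacian G ?f z = (\<Sum>w \<in> ?N. ?f w - 1) / k - 1" .
  have S: "0 \<le> (\<Sum>w \<in> ?N. ?f w - 1)" by (rule sum_nonneg) (rule nn)
  then have "0 \<le> (\<Sum>w \<in> ?N. ?f w - 1) / k" using k by (simp only: divide_nonneg_pos)
  then show "- 1 \<le> graph_laplacian G ?f z" unfolding L by linarith
  assume "graph_laplacian G ?f z \<le> - 1" and w: "(z, w) \<in> parcs G"
  then have "(\<Sum>w \<in> ?N. ?f w - 1) / k \<le> 0" unfolding L by simp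
  then have "(\<Sum>w \<in> ?N. ?f w - 1) \<le> 0" using k by (simp only: pos_divide_le_eq mult_zero_left)
  with S have "(\<Sum>w \<in> ?N. ?f w - 1) = 0" by (rule antisym[rotated])
  then have "?f w - 1 = 0"
    using sum_nonneg_eq_0_iff[of ?N "\<lambda>w. ?f w - 1"] nn w by simp
  then show "(x, w) \<in> parcs G" using f[of w] w by (simp split: if_splits)
qed

lemma lly_curvature_le_dist_nbr:
  assumes "(x, y) \<in> parcs G"
  shows "lly_curvature G x y \<le> 1 - graph_laplacian G (graph_dist G x) y"
proof -
  have x: "x \<in> pverts G" using assms by (rule in_arcsD1)
  have "lly_curvature G x y
      \<le> graph_laplacian G (graph_dist G x) x - graph_laplacian G (graph_dist G x) y"
    by (rule lly_curvature_le_lipschitz[OF assms lipschitz_graph_dist[OF x]])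
       (simp_all add: graph_dist_arc[OF assms] graph_dist_self[OF x])
  then show ?thesis by (simp add: graph_laplacian_dist_self[OF assms])
qed

text \<open>The second edge of a geodesic \<open>x\<close>, \<open>y\<close>, \<open>z\<close>: the
  Laplacian at \<open>y\<close> has the sign opposite to the bound for the first edge, so it cancels
  when both are added.\<close>

lemma lly_curvature_le_dist_nonadjacent:
  assumes "x \<in> pverts G" "x \<noteq> z" "(x, z) \<notin> parcs G" "(x, y) \<in> parcs G" "(y, z) \<in> parcs G"
  shows "lly_curvature G y z
    \<le> graph_laplacian G (graph_dist G x) y - graph_laplacian G (graph_dist G x) z"
proof (rule lly_curvature_le_lipschitz[OF assms(5) lipschitz_graph_dist[OF assms(1)]])
  have "z \<in> pverts G" using assms(5) by (rule in_arcsD2)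
  then show "graph_dist G x z - graph_dist G x y = 1"
    using assms graph_dist_eq[OF assms(1)] by (simp add: graph_dist_arc)
qed

text \<open>The complement graph has maximal degree at most 1, that is, its edges form a matching.
  This mediates between curvature and edge deletion.\<close>

definition unique_nonnbr :: bool where
  "unique_nonnbr \<longleftrightarrow> (\<forall>x \<in> pverts G. \<forall>z \<in> pverts G. \<forall>z' \<in> pverts G.
     z \<noteq> x \<longrightarrow> (x, z) \<notin> parcs G \<longrightarrow> z' \<noteq> x \<longrightarrow> (x, z') \<notin> parcs G \<longrightarrow> z = z')"

text \<open>Let \<open>y\<close> be a common neighbour of \<open>x\<close> and \<open>z\<close>.
  Curvature at least 1 on the edge from \<open>x\<close> to \<open>y\<close> makes the Laplacian of
  \<open>graph_dist G x\<close> at \<open>y\<close> nonpositive; then the edge from \<open>y\<close>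
  to \<open>z\<close> pushes it at \<open>z\<close> down to its extreme value -1.\<close>

lemma nbr_of_nonadjacent:
  assumes curv: "\<And>x y. (x, y) \<in> parcs G \<Longrightarrow> 1 \<le> lly_curvature G x y"
    and xz: "x \<in> pverts G" "z \<in> pverts G" "x \<noteq> z" "(x, z) \<notin> parcs G"
    and w: "(z, w) \<in> parcs G"
  shows "(x, w) \<in> parcs G"
proof (rule graph_laplacian_dist_nonadjacent(2)[OF xz _ w])
  obtain y where y: "(x, y) \<in> parcs G" "(y, z) \<in> parcs G" using common_nbr[OF xz] .
  have "1 \<le> 1 - graph_laplacian G (graph_dist G x) y"
    using curv[OF y(1)] lly_curvature_le_dist_nbr[OF y(1)] by linarith
  moreover have "1 \<le> graph_laplacian G (graph_dist G x) y - graph_laplacian G (graph_dist G x) z"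
    using curv[OF y(2)] lly_curvature_le_dist_nonadjacent[OF xz(1,3,4) y] by linarith
  ultimately show "graph_laplacian G (graph_dist G x) z \<le> - 1" by linarith
qed

text \<open>A common neighbour \<open>y\<close> of \<open>x\<close> and \<open>z\<close> is adjacent
  to \<open>z'\<close> too. Then \<open>y\<close> has two neighbours farther from \<open>x\<close>
  and only one nearer, so the Laplacian at \<open>y\<close> is positive, against the curvature of
  the edge from \<open>x\<close> to \<open>y\<close>.\<close>

lemma unique_nonnbr_if_lly_curvature_ge_1:
  assumes curv: "\<And>x y. (x, y) \<in> parcs G \<Longrightarrow> 1 \<le> lly_curvature G x y"
  shows unique_nonnbr
  unfolding unique_nonnbr_def
proof (intro ballI impI, rule ccontr)
  fix x z z' assume V: "x \<in> pverts G" "z \<in> pverts G" "z' \<in> pverts G"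
    and z: "z \<noteq> x" "(x, z) \<notin> parcs G" and z': "z' \<noteq> x" "(x, z') \<notin> parcs G" and "z \<noteq> z'"
  obtain y where y: "(x, y) \<in> parcs G" "(y, z) \<in> parcs G"
    using common_nbr[of x z] V z by metis
  have yz': "(y, z') \<in> parcs G"
    using nbr_of_nonadjacent[OF curv, of z' x y] V z' y(1) arcs_symmetric by metis
  let ?N = "{w. (y, w) \<in> parcs G}" and ?f = "graph_dist G x"
  have fy: "?f y = 1" using y(1) by (rule graph_dist_arc)
  have sub: "{x, z, z'} \<subseteq> ?N" using y yz' arcs_symmetric by auto
  \<comment> \<open>\<open>x\<close> contributes -1, while \<open>z\<close> and \<open>z'\<close>
    contribute 1 each.\<close>
  have "1 = (\<Sum>w \<in> {x, z, z'}. ?f w - ?f y)"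
    using V z z' \<open>z \<noteq> z'\<close> by (auto simp: fy graph_dist_eq)
  also have "\<dots> \<le> (\<Sum>w \<in> ?N. ?f w - ?f y)"
  proof (rule sum_mono2[OF finite_nbrs sub])
    fix w assume "w \<in> ?N - {x, z, z'}"
    then have "w \<in> pverts G" "x \<noteq> w" by (auto dest: in_arcsD2)
    then show "0 \<le> ?f w - ?f y" using graph_dist_ge_1[OF V(1)] by (simp add: fy)
  qed
  finally have "0 < graph_laplacian G ?f y"
    unfolding graph_laplacian_def using out_degree_pos[OF y(2)] by simp
  moreover have "1 \<le> 1 - graph_laplacian G ?f y"
    using curv[OF y(1)] lly_curvature_le_dist_nbr[OF y(1)] by linarith
  ultimately show False by linarith
qed

text \<open>
  At idleness \<open>1 / (d\<^sub>x + 1)\<close> the measure of \<open>x\<close> is uniform on its closed neighbourhood, so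
  its excess over that of \<open>y\<close> is concentrated on the non-neighbour of \<open>y\<close>, if there is one.
\<close>

lemma lly_curvature_ge_1_if_degree_le:
  assumes U: unique_nonnbr and xy: "(x, y) \<in> parcs G"
    and deg: "out_degree (with_proj G) y \<le> out_degree (with_proj G) x"
  shows "1 \<le> lly_curvature G x y"
proof -
  define D where "D = real (out_degree (with_proj G) x)"
  define D' where "D' = real (out_degree (with_proj G) y)"
  define q where "q = 1 / (D + 1)"
  have yx: "(y, x) \<in> parcs G" using xy by (rule arcs_symmetric)
  have D: "0 < D" "0 < D'" "D' \<le> D"
    using out_degree_pos[OF xy] out_degree_pos[OF yx] deg by (simp_all add: D_def D'_def)
  have q: "0 < q" "q < 1" using D by (simp_all add: q_def field_simps)
  have "1 - q = D * q" using D by (simp add: q_def field_simps)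
  then have qD: "(1 - q) / D = q" using D by simp
  \<comment> \<open>As \<open>y\<close> has the smaller degree, each of its neighbours carries at
    least \<open>q\<close>.\<close>
  have "(1 - q) / D \<le> (1 - q) / D'"
    using D q by (intro divide_left_mono mult_pos_pos) auto
  then have qD': "q \<le> (1 - q) / D'" by (simp add: qD)
  have V: "x \<in> pverts G" "y \<in> pverts G" using xy by (auto dest: in_arcsD1 in_arcsD2)
  let ?m = "lazy_measure G q x" and ?m' = "lazy_measure G q y"
  have m_le: "?m v \<le> q" for v
    using q qD by (simp add: lazy_measure_def flip: D_def)
  have m': "0 \<le> ?m' v" for v using q by (intro lazy_measure_nonneg) auto
  have m'_ge: "q \<le> ?m' v" if "v = y \<or> (y, v) \<in> parcs G" for v
    using that qD' by (auto simp: lazy_measure_def simp flip: D'_def)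
  let ?S = "{v \<in> pverts G. v \<noteq> y \<and> (y, v) \<notin> parcs G}"
  have excess: "v \<in> ?S" if "v \<in> pverts G" "?m' v < ?m v" for v
    using that m_le[of v] m'_ge[of v] by (simp, meson dual_order.strict_trans1 leD)
  have S: "v = w" if "v \<in> ?S" "w \<in> ?S" for v w
    using that U V unfolding unique_nonnbr_def by blast
  have "wasserstein G ?m ?m' \<le> transport_cost G (excess_plan G ?m ?m')"
    by (rule wasserstein_le, rule excess_plan_in_transport_plans)
       (use q in \<open>auto intro: lazy_measure_nonneg simp: sum_lazy_measure_1[OF xy] sum_lazy_measure_1[OF yx]\<close>)
  also have "\<dots> \<le> (\<Sum>v \<in> pverts G. max 0 (?m v - ?m' v))"
  proof (rule transport_cost_excess_plan)
    show "sum ?m (pverts G) = sum ?m' (pverts G)"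
      by (simp add: sum_lazy_measure_1[OF xy] sum_lazy_measure_1[OF yx])
    show "graph_dist G v v = 0" if "v \<in> pverts G" for v using that by (rule graph_dist_self)
    fix v w assume vw: "v \<in> pverts G" "w \<in> pverts G" "?m' v < ?m v" "?m w < ?m' w"
    \<comment> \<open>\<open>y\<close> gets \<open>q\<close> once as a neighbour of \<open>x\<close>
      and once as idle mass, so it has neither excess nor deficit.\<close>
    have "?m y = q" "?m' y = q"
      using xy no_loops'[OF xy] qD by (auto simp: lazy_measure_def simp flip: D_def)
    then have w: "w \<noteq> y" "w \<noteq> v" using vw by auto
    have "v \<in> ?S" using vw by (intro excess)
    then have v: "y \<noteq> v" "(v, y) \<notin> parcs G" by (auto dest: arcs_symmetric)
    \<comment> \<open>The only non-neighbour of \<open>v\<close> is \<open>y\<close>, so the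
      receiving vertex \<open>w\<close> is adjacent to \<open>v\<close>.\<close>
    have "(v, w) \<in> parcs G"
      using U[unfolded unique_nonnbr_def, rule_format, OF vw(1) V(2) vw(2) v w(2)] w(1) by metis
    then show "graph_dist G v w \<le> 1" by (simp add: graph_dist_arc)
  qed
  also have "\<dots> = (\<Sum>v \<in> ?S. max 0 (?m v - ?m' v))"
  proof (rule sum.mono_neutral_right)
    show "\<forall>v \<in> pverts G - ?S. max 0 (?m v - ?m' v) = 0"
    proof
      fix v assume "v \<in> pverts G - ?S"
      with excess[of v] have "\<not> ?m' v < ?m v" by blast
      then show "max 0 (?m v - ?m' v) = 0" by simp
    qed
  qed (use pair_finite_verts in auto)
  also have "\<dots> \<le> (\<Sum>v \<in> ?S. q)"
  proof (rule sum_mono)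
    fix v show "max 0 (?m v - ?m' v) \<le> q" using m_le[of v] m'[of v] q by linarith
  qed
  also have "\<dots> \<le> q"
  proof -
    have "card ?S \<le> Suc 0"
      by (subst card_le_Suc0_iff_eq) (use S pair_finite_verts in auto)
    then show ?thesis using q by (simp add: mult_left_le_one_le)
  qed
  finally have "1 - q \<le> ollivier_curvature G q x y"
    by (simp add: ollivier_curvature_def)
  then have "1 \<le> ollivier_curvature G q x y / (1 - q)"
    using q by (simp add: pos_le_divide_eq)
  also have "\<dots> \<le> lly_curvature G x y"
    by (rule lly_curvature_ge[OF xy]) (use q in auto)
  finally show ?thesis .
qed

lemma lly_curvature_ge_1_iff_unique_nonnbr:
  "(\<forall>(x, y) \<in> parcs G. 1 \<le> lly_curvature G x y) \<longleftrightarrow> unique_nonnbr"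
proof
  assume "\<forall>(x, y) \<in> parcs G. 1 \<le> lly_curvature G x y"
  then show unique_nonnbr by (intro unique_nonnbr_if_lly_curvature_ge_1) auto
next
  assume U: unique_nonnbr
  \<comment> \<open>The degrees are comparable one way or the other, and the curvature is
    symmetric.\<close>
  have "1 \<le> lly_curvature G x y" if "(x, y) \<in> parcs G" for x y
    using lly_curvature_ge_1_if_degree_le[OF U that]
      lly_curvature_ge_1_if_degree_le[OF U arcs_symmetric[OF that]]
    by (metis lly_curvature_commute nle_le)
  then show "\<forall>(x, y) \<in> parcs G. 1 \<le> lly_curvature G x y" by auto
qed

text \<open>Along a geodesic to a non-neighbour \<open>z\<close>, the two bounds add up to 1 minus
  the Laplacian at \<open>z\<close>, hence to at most 2.\<close>

lemma ex_lly_curvature_le_1: "\<exists>(x, y) \<in> parcs G. lly_curvature G x y \<le> 1"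
proof -
  obtain x z where xz: "x \<in> pverts G" "z \<in> pverts G" "x \<noteq> z" "(x, z) \<notin> parcs G"
    using ex_nonadjacent .
  obtain y where y: "(x, y) \<in> parcs G" "(y, z) \<in> parcs G" using common_nbr[OF xz] .
  have "lly_curvature G x y + lly_curvature G y z \<le> 2"
    using lly_curvature_le_dist_nbr[OF y(1)] lly_curvature_le_dist_nonadjacent[OF xz(1,3,4) y]
      graph_laplacian_dist_nonadjacent(1)[OF xz] by linarith
  then have "lly_curvature G x y \<le> 1 \<or> lly_curvature G y z \<le> 1" by linarith
  with y show ?thesis by auto
qed

text \<open>Here \<open>2 / diam G\<close> is 1 and some edge has curvature at most 1, so sharpness
  only asks that no curvature be below 1.\<close>

lemma bonnet_myers_sharp_iff_unique_nonnbr: "bonnet_myers_sharp G \<longleftrightarrow> unique_nonnbr"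
proof -
  let ?K = "(\<lambda>(x, y). lly_curvature G x y) ` parcs G"
  have fin: "finite ?K" using pair_finite_arcs by simp
  obtain a where a: "a \<in> parcs G" "(case a of (x, y) \<Rightarrow> lly_curvature G x y) \<le> 1"
    using ex_lly_curvature_le_1 by (auto split: prod.splits)
  have "Inf ?K \<le> 1"
    using cINF_lower[OF bdd_below_finite[OF fin] a(1)] a(2) by simp
  then have "bonnet_myers_sharp G \<longleftrightarrow> 1 \<le> Inf ?K"
    by (auto simp: bonnet_myers_sharp_def diam_eq)
  also have "\<dots> \<longleftrightarrow> (\<forall>k \<in> ?K. 1 \<le> k)"
    using a(1) by (intro le_cInf_iff bdd_below_finite fin) auto
  also have "\<dots> \<longleftrightarrow> unique_nonnbr"
    unfolding lly_curvature_ge_1_iff_unique_nonnbr[symmetric] by auto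
  finally show ?thesis .
qed

text \<open>Non-neighbours of \<open>x\<close> are joined to it by deleted edges, and edges of a
  matching that share \<open>x\<close> coincide.\<close>

lemma unique_nonnbr_if_delete_matching:
  assumes K: "complete_digraph n (with_proj K)" and M: "matching K M" and G: "G = delete_edges K M"
  shows unique_nonnbr
  unfolding unique_nonnbr_def
proof (intro ballI impI)
  fix x z z' assume V: "x \<in> pverts G" "z \<in> pverts G" "z' \<in> pverts G"
    and z: "z \<noteq> x" "(x, z) \<notin> parcs G" and z': "z' \<noteq> x" "(x, z') \<notin> parcs G"
  have KG: "pverts K = pverts G" "parcs G = {(u, v) \<in> parcs K. {u, v} \<notin> M}"
    by (simp_all add: G delete_edges_def)
  have "(x, z) \<in> parcs K" "(x, z') \<in> parcs K"
    using K V z(1) z'(1) by (auto simp: complete_digraph_pair_def KG)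
  then have "{x, z} \<in> M" "{x, z'} \<in> M" using z(2) z'(2) by (auto simp: KG(2))
  moreover have "\<not> disjnt {x, z} {x, z'}" by (simp add: disjnt_def)
  ultimately have "{x, z} = {x, z'}"
    using M pairwiseD[of disjnt M "{x, z}" "{x, z'}"] by (auto simp only: matching_def)
  then show "z = z'" by (auto simp: doubleton_eq_iff)
qed

text \<open>The witnesses are the complete graph on the vertices of \<open>G\<close> and the set of
  all non-edges of \<open>G\<close>.\<close>

lemma delete_matching_if_unique_nonnbr:
  assumes U: unique_nonnbr
  shows "\<exists>K M. complete_digraph (card (pverts G)) (with_proj K) \<and> matching K M \<and> G = delete_edges K M"
proof (intro exI conjI)
  let ?K = "\<lparr>pverts = pverts G, parcs = {(u, v). (u, v) \<in> pverts G \<times> pverts G \<and> u \<noteq> v}\<rparr>"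
  let ?M = "{{u, v} | u v. u \<in> pverts G \<and> v \<in> pverts G \<and> u \<noteq> v \<and> (u, v) \<notin> parcs G}"
  show "complete_digraph (card (pverts G)) (with_proj ?K)"
    by (simp add: complete_digraph_pair_def pair_finite_verts)
  have "?M \<subseteq> undirected_edges ?K" by (auto simp: undirected_edges_def)
  moreover have "pairwise disjnt ?M"
  proof (rule pairwiseI, rule ccontr)
    fix e e' assume "e \<in> ?M" "e' \<in> ?M" "e \<noteq> e'" "\<not> disjnt e e'"
    then obtain w where w: "w \<in> e" "w \<in> e'" by (auto simp: disjnt_iff)
    \<comment> \<open>Reads an unordered non-edge from its endpoint \<open>w\<close>, so that
      uniqueness applies at the shared vertex.\<close>
    have other: "\<exists>v \<in> pverts G. e = {w, v} \<and> w \<in> pverts G \<and> v \<noteq> w \<and> (w, v) \<notin> parcs G"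
      if "e \<in> ?M" "w \<in> e" for e
      using that arcs_symmetric by (auto simp: insert_commute)
    from other[OF \<open>e \<in> ?M\<close> w(1)] other[OF \<open>e' \<in> ?M\<close> w(2)] U \<open>e \<noteq> e'\<close>
    show False unfolding unique_nonnbr_def by metis
  qed
  ultimately show "matching ?K ?M" by (simp add: matching_def)
  have "G = delete_edges ?K M"
    if "\<And>u v. (u, v) \<in> parcs G \<longleftrightarrow> u \<in> pverts G \<and> v \<in> pverts G \<and> u \<noteq> v \<and> {u, v} \<notin> M" for M
    by (rule pair_pre_digraph.equality) (auto simp: delete_edges_def that)
  moreover have "(u, v) \<in> parcs G \<longleftrightarrow> u \<in> pverts G \<and> v \<in> pverts G \<and> u \<noteq> v \<and> {u, v} \<notin> ?M" for u v
    using arcs_symmetric no_loops' in_arcsD1 in_arcsD2 by (auto simp: doubleton_eq_iff)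
  ultimately show "G = delete_edges ?K ?M" by blast
qed

end

theorem theorem1p3:
  fixes G :: "'a pair_pre_digraph" and n :: nat
  assumes "pair_graph G"
    and "Digraph_Component.connected (with_proj G)"
    and "diam G = 2"
    and "card (pverts G) = n"
  shows "bonnet_myers_sharp G \<longleftrightarrow>
    (\<exists>K M. complete_digraph n (with_proj K) \<and> matching K M \<and> G = delete_edges K M)"
proof -
  interpret pair_graph G by fact
  interpret diam2_graph G by unfold_locales fact+
  show ?thesis
    using delete_matching_if_unique_nonnbr unique_nonnbr_if_delete_matching[of n]
    by (auto simp: bonnet_myers_sharp_iff_unique_nonnbr assms(4))
qed

end
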